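(* Let $\mathbf z^1$ be a transit network design and $r\in T'$ a trip. Assume that the optimal route for trip $r$ under $\mathbf z^1$ includes the shuttle trips from origin $or^r$ to hub $m$ and from hub $n$ to destination $de^r$, where $m$ and $n$ are the closest active hubs to the origin and destination, i.e., $d_{or^rm}=\overrightarrow d^{\min}_{or^r}(\mathbf z^1)$ and $d_{nde^r}=\overleftarrow d^{\min}_{de^r}(\mathbf z^1)$, and that the rider of trip $r$ adopts the ODMTS under $\mathbf z^1$. Then the consistency cut for $r$ at $\mathbf z^1$ becomes the (valid) inequality $$\sum_{h\in\overrightarrow W_{or^r}(\mathbf z^1)\cup\overleftarrow W_{de^r}(\mathbf z^1),\ l\in H}z_{hl}+\sum_{(h,l):z^1_{hl}=1}(1-z_{hl})+\delta^r\ge1.$$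
   Context: $N$ is a finite set of nodes, $H\subseteq N$ the set of hubs, $T'$ the set of trips with mode choice. Trip $r$ has distinct origin $or^r$ and destination $de^r$ in $N\setminus H$. For $i,j\in N$, $t_{ij}\ge0$ and $d_{ij}\ge0$ are travel time and distance (possibly asymmetric), each satisfying the triangle inequality. $\theta\in[0,1]$, $g\ge0$ is the shuttle cost per mile, $s\ge0$ the average bus waiting time. Put $\gamma^r_{ij}=(1-\theta)g\,d_{ij}+\theta t_{ij}$ and $\tau^r_{hl}=\theta(t_{hl}+s)$. A design is a $\mathbf z\in\{0,1\}^{|H|\times|H|}$ ($z_{hl}=1$ iff the bus leg from $h$ to $l$ is open) satisfying weak connectivity: $\sum_{l\in H}z_{hl}=\sum_{l\in H}z_{lh}$ for all $h\in H$. Given $\mathbf z$, the optimal route of $r$ is a solution of: lexicographically minimize $\langle b^r,f^r\rangle$ (first $b^r$, then $f^r$) over binary $x^r_{hl}$ ($h,l\in H$) and $y^r_{ij}$ ($(i,j)\in A^r$), with $b^r=\sum\tau^r_{hl}x^r_{hl}+\sum\gamma^r_{ij}y^r_{ij}$, $f^r=\sum(t_{hl}+s)x^r_{hl}+\sum t_{ij}y^r_{ij}$, subject to $x^r_{hl}\le z_{hl}$ and unit flow conservation from $or^r$ to $de^r$ over bus legs ($x$) and shuttle legs ($y$). Here $A^r=\{(or^r,h),(h,de^r):h\in H\}\cup\{(or^r,de^r)\}$. A route is either a direct shuttle ride from $or^r$ to $de^r$, or a shuttle from $or^r$ to a hub, bus leg(s), and a shuttle from a hub to $de^r$. The trip time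 is the lexicographically optimal $f^r$ (unique for given $\mathbf z$). With given positive $\alpha^r$, $t^r_{cur}$, the rider of $r$ adopts the system under $\mathbf z$ iff the trip time under $\mathbf z$ is at most $\alpha^rt^r_{cur}$; correspondingly, in the design problem $\delta^r\in\{0,1\}$ is constrained to equal $1$ iff the rider adopts under $\mathbf z$. An inequality in $(\mathbf z,\delta^r)$ is valid if every $(\mathbf z,\delta^r)$ feasible for the design problem (in particular $\mathbf z$ weakly connected) satisfies it. Active hubs: $\mathcal H(\mathbf z)=\{h\in H:\sum_{l\in H}z_{hl}>0\}$. For $i\in N$: $\overrightarrow d^{\min}_i(\mathbf z)=\min_{h\in\mathcal H(\mathbf z)}d_{ih}$, $\overleftarrow d^{\min}_i(\mathbf z)=\min_{h\in\mathcal H(\mathbf z)}d_{hi}$, $\overrightarrow W_i(\mathbf z)=\{h\in H\setminus\mathcal H(\mathbf z):d_{ih}<\overrightarrow d^{\min}_i(\mathbf z)\}$, $\overleftarrow W_i(\mathbf z)=\{h\in H\setminus\mathcal H(\mathbf z):d_{hi}<\overleftarrow d^{\min}_i(\mathbf z)\}$. The basic consistency cut being strengthened is $\sum_{(h,l):z^1_{hl}=0}z_{hl}+\sum_{(h,l):z^1_{hl}=1}(1-z_{hl})+\delta^r\ge1$. *)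

theory Defs
  imports Complex_Main
begin

record ('n, 'r) odmts =
  nodes :: "'n set"
  hubs :: "'n set"
  trips :: "'r set"
  orig :: "'r \<Rightarrow> 'n"
  dest :: "'r \<Rightarrow> 'n"
  travel_time :: "'n \<Rightarrow> 'n \<Rightarrow> real"
  distance :: "'n \<Rightarrow> 'n \<Rightarrow> real"
  theta :: real
  shuttle_cost :: real
  bus_wait :: real
  alpha :: "'r \<Rightarrow> real"
  t_cur :: "'r \<Rightarrow> real"

definition odmts_instance :: "('n, 'r) odmts \<Rightarrow> bool" where
  "odmts_instance I \<longleftrightarrow>
     finite (nodes I) \<and> hubs I \<subseteq> nodes I \<and>
     (\<forall>r\<in>trips I. orig I r \<in> nodes I - hubs I \<and> dest I r \<in> nodes I - hubs I \<and>
        orig I r \<noteq> dest I r \<and> alpha I r > 0 \<and> t_cur I r > 0) \<and>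
     (\<forall>i\<in>nodes I. \<forall>j\<in>nodes I. travel_time I i j \<ge> 0 \<and> distance I i j \<ge> 0) \<and>
     (\<forall>i\<in>nodes I. \<forall>j\<in>nodes I. \<forall>k\<in>nodes I.
        travel_time I i k \<le> travel_time I i j + travel_time I j k \<and>
        distance I i k \<le> distance I i j + distance I j k) \<and>
     0 \<le> theta I \<and> theta I \<le> 1 \<and> shuttle_cost I \<ge> 0 \<and> bus_wait I \<ge> 0"

text \<open>The decision vectors \<open>z\<close>, \<open>x\<close>, \<open>y\<close> are real-valued functions of pairs of nodes.
  Only their values on \<open>H \<times> H\<close> (for \<open>z\<close> and \<open>x\<close>) and on the shuttle arcs of the trip
  (for \<open>y\<close>) are ever constrained or read.\<close>

definition binary_on :: "('n \<times> 'n) set \<Rightarrow> ('n \<Rightarrow> 'n \<Rightarrow> real) \<Rightarrow> bool" where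
  "binary_on A u \<longleftrightarrow> (\<forall>(i, j)\<in>A. u i j \<in> {0, 1})"

definition transit_design :: "('n, 'r) odmts \<Rightarrow> ('n \<Rightarrow> 'n \<Rightarrow> real) \<Rightarrow> bool" where
  "transit_design I z \<longleftrightarrow>
     binary_on (hubs I \<times> hubs I) z \<and>
     (\<forall>h\<in>hubs I. (\<Sum>l\<in>hubs I. z h l) = (\<Sum>l\<in>hubs I. z l h))"

definition shuttle_weight :: "('n, 'r) odmts \<Rightarrow> 'n \<Rightarrow> 'n \<Rightarrow> real" where
  "shuttle_weight I i j =
     (1 - theta I) * shuttle_cost I * distance I i j + theta I * travel_time I i j"

definition bus_weight :: "('n, 'r) odmts \<Rightarrow> 'n \<Rightarrow> 'n \<Rightarrow> real" where
  "bus_weight I h l = theta I * (travel_time I h l + bus_wait I)"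

definition shuttle_arcs :: "('n, 'r) odmts \<Rightarrow> 'r \<Rightarrow> ('n \<times> 'n) set" where
  "shuttle_arcs I r =
     {orig I r} \<times> hubs I \<union> hubs I \<times> {dest I r} \<union> {(orig I r, dest I r)}"

definition route_weight ::
    "('n, 'r) odmts \<Rightarrow> 'r \<Rightarrow> ('n \<Rightarrow> 'n \<Rightarrow> real) \<Rightarrow> ('n \<Rightarrow> 'n \<Rightarrow> real) \<Rightarrow> real" where
  "route_weight I r x y =
     (\<Sum>(h, l)\<in>hubs I \<times> hubs I. bus_weight I h l * x h l) +
     (\<Sum>(i, j)\<in>shuttle_arcs I r. shuttle_weight I i j * y i j)"

definition route_time ::
    "('n, 'r) odmts \<Rightarrow> 'r \<Rightarrow> ('n \<Rightarrow> 'n \<Rightarrow> real) \<Rightarrow> ('n \<Rightarrow> 'n \<Rightarrow> real) \<Rightarrow> real" where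
  "route_time I r x y =
     (\<Sum>(h, l)\<in>hubs I \<times> hubs I. (travel_time I h l + bus_wait I) * x h l) +
     (\<Sum>(i, j)\<in>shuttle_arcs I r. travel_time I i j * y i j)"

definition net_outflow ::
    "('n, 'r) odmts \<Rightarrow> 'r \<Rightarrow> ('n \<Rightarrow> 'n \<Rightarrow> real) \<Rightarrow> ('n \<Rightarrow> 'n \<Rightarrow> real) \<Rightarrow> 'n \<Rightarrow> real" where
  "net_outflow I r x y i =
     (if i \<in> hubs I then (\<Sum>l\<in>hubs I. x i l) - (\<Sum>l\<in>hubs I. x l i) else 0) +
     (\<Sum>j | (i, j) \<in> shuttle_arcs I r. y i j) - (\<Sum>j | (j, i) \<in> shuttle_arcs I r. y j i)"

definition feasible_route ::
    "('n, 'r) odmts \<Rightarrow> ('n \<Rightarrow> 'n \<Rightarrow> real) \<Rightarrow> 'r \<Rightarrow>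
     ('n \<Rightarrow> 'n \<Rightarrow> real) \<Rightarrow> ('n \<Rightarrow> 'n \<Rightarrow> real) \<Rightarrow> bool" where
  "feasible_route I z r x y \<longleftrightarrow>
     binary_on (hubs I \<times> hubs I) x \<and> binary_on (shuttle_arcs I r) y \<and>
     (\<forall>h\<in>hubs I. \<forall>l\<in>hubs I. x h l \<le> z h l) \<and>
     (\<forall>i\<in>nodes I. net_outflow I r x y i =
        (if i = orig I r then 1 else if i = dest I r then -1 else 0))"

definition optimal_route ::
    "('n, 'r) odmts \<Rightarrow> ('n \<Rightarrow> 'n \<Rightarrow> real) \<Rightarrow> 'r \<Rightarrow>
     ('n \<Rightarrow> 'n \<Rightarrow> real) \<Rightarrow> ('n \<Rightarrow> 'n \<Rightarrow> real) \<Rightarrow> bool" where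
  "optimal_route I z r x y \<longleftrightarrow>
     feasible_route I z r x y \<and>
     (\<forall>x' y'. feasible_route I z r x' y' \<longrightarrow>
        route_weight I r x y < route_weight I r x' y' \<or>
        route_weight I r x y = route_weight I r x' y' \<and> route_time I r x y \<le> route_time I r x' y')"

definition trip_time :: "('n, 'r) odmts \<Rightarrow> ('n \<Rightarrow> 'n \<Rightarrow> real) \<Rightarrow> 'r \<Rightarrow> real" where
  "trip_time I z r = (THE f. \<exists>x y. optimal_route I z r x y \<and> f = route_time I r x y)"

definition adopts :: "('n, 'r) odmts \<Rightarrow> ('n \<Rightarrow> 'n \<Rightarrow> real) \<Rightarrow> 'r \<Rightarrow> bool" where
  "adopts I z r \<longleftrightarrow> trip_time I z r \<le> alpha I r * t_cur I r"

definition design_feasible ::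
    "('n, 'r) odmts \<Rightarrow> ('n \<Rightarrow> 'n \<Rightarrow> real) \<Rightarrow> ('r \<Rightarrow> real) \<Rightarrow> bool" where
  "design_feasible I z \<delta> \<longleftrightarrow>
     transit_design I z \<and>
     (\<forall>r\<in>trips I. \<delta> r \<in> {0, 1} \<and> (\<delta> r = 1 \<longleftrightarrow> adopts I z r))"

text \<open>Validity of an inequality in \<open>z\<close> and the single adoption variable \<open>\<delta> r\<close>.\<close>

definition valid_cut ::
    "('n, 'r) odmts \<Rightarrow> 'r \<Rightarrow> (('n \<Rightarrow> 'n \<Rightarrow> real) \<Rightarrow> real \<Rightarrow> bool) \<Rightarrow> bool" where
  "valid_cut I r P \<longleftrightarrow> (\<forall>z \<delta>. design_feasible I z \<delta> \<longrightarrow> P z (\<delta> r))"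

definition active_hubs :: "('n, 'r) odmts \<Rightarrow> ('n \<Rightarrow> 'n \<Rightarrow> real) \<Rightarrow> 'n set" where
  "active_hubs I z = {h \<in> hubs I. (\<Sum>l\<in>hubs I. z h l) > 0}"

text \<open>The two minima below are meaningful only if some hub is active.\<close>

definition dmin_from :: "('n, 'r) odmts \<Rightarrow> ('n \<Rightarrow> 'n \<Rightarrow> real) \<Rightarrow> 'n \<Rightarrow> real" where
  "dmin_from I z i = (MIN h\<in>active_hubs I z. distance I i h)"

definition dmin_to :: "('n, 'r) odmts \<Rightarrow> ('n \<Rightarrow> 'n \<Rightarrow> real) \<Rightarrow> 'n \<Rightarrow> real" where
  "dmin_to I z i = (MIN h\<in>active_hubs I z. distance I h i)"

definition W_from :: "('n, 'r) odmts \<Rightarrow> ('n \<Rightarrow> 'n \<Rightarrow> real) \<Rightarrow> 'n \<Rightarrow> 'n set" where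
  "W_from I z i = {h \<in> hubs I - active_hubs I z. distance I i h < dmin_from I z i}"

definition W_to :: "('n, 'r) odmts \<Rightarrow> ('n \<Rightarrow> 'n \<Rightarrow> real) \<Rightarrow> 'n \<Rightarrow> 'n set" where
  "W_to I z i = {h \<in> hubs I - active_hubs I z. distance I h i < dmin_to I z i}"

definition consistency_cut ::
    "('n, 'r) odmts \<Rightarrow> ('n \<Rightarrow> 'n \<Rightarrow> real) \<Rightarrow> ('n \<Rightarrow> 'n \<Rightarrow> real) \<Rightarrow> real \<Rightarrow> bool" where
  "consistency_cut I z1 z \<delta>r \<longleftrightarrow>
     (\<Sum>(h, l) | h \<in> hubs I \<and> l \<in> hubs I \<and> z1 h l = 0. z h l) +
     (\<Sum>(h, l) | h \<in> hubs I \<and> l \<in> hubs I \<and> z1 h l = 1. 1 - z h l) + \<delta>r \<ge> 1"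

definition strengthened_cut ::
    "('n, 'r) odmts \<Rightarrow> 'r \<Rightarrow> ('n \<Rightarrow> 'n \<Rightarrow> real) \<Rightarrow> ('n \<Rightarrow> 'n \<Rightarrow> real) \<Rightarrow> real \<Rightarrow> bool" where
  "strengthened_cut I r z1 z \<delta>r \<longleftrightarrow>
     (\<Sum>(h, l)\<in>(W_from I z1 (orig I r) \<union> W_to I z1 (dest I r)) \<times> hubs I. z h l) +
     (\<Sum>(h, l) | h \<in> hubs I \<and> l \<in> hubs I \<and> z1 h l = 1. 1 - z h l) + \<delta>r \<ge> 1"

text \<open>The description in \<open>trip_time\<close> is proper: optimal routes exist, and all of them have
  the same trip time.\<close>

lemma trip_time_eq:
  assumes "optimal_route I z r x y"
  shows "trip_time I z r = route_time I r x y"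
  unfolding trip_time_def
proof (rule the_equality)
  show "\<exists>x' y'. optimal_route I z r x' y' \<and> route_time I r x y = route_time I r x' y'"
    using assms by blast
next
  fix f assume "\<exists>x y. optimal_route I z r x y \<and> f = route_time I r x y"
  then obtain x' y' where *: "optimal_route I z r x' y'" "f = route_time I r x' y'" by blast
  have "feasible_route I z r x y" "feasible_route I z r x' y'"
    using assms * by (auto simp: optimal_route_def)
  then show "f = route_time I r x y"
    using assms * unfolding optimal_route_def by force
qed

lemma sum_binary:
  fixes c :: "'n \<Rightarrow> 'n \<Rightarrow> real"
  assumes "finite A" "binary_on A u"
  shows "(\<Sum>(i, j)\<in>A. c i j * u i j) = (\<Sum>(i, j)\<in>{p \<in> A. u (fst p) (snd p) = 1}. c i j)"
proof -
  have "(\<Sum>(i, j)\<in>A. c i j * u i j) =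
      (\<Sum>p\<in>A. if u (fst p) (snd p) = 1 then c (fst p) (snd p) else 0)"
    using assms(2) by (intro sum.cong) (auto simp: binary_on_def)
  also have "\<dots> = (\<Sum>(i, j)\<in>{p \<in> A. u (fst p) (snd p) = 1}. c i j)"
    using assms(1) by (simp add: sum.inter_filter case_prod_beta)
  finally show ?thesis .
qed

lemma direct_route_feasible:
  assumes "odmts_instance I" "transit_design I z" "r \<in> trips I"
  shows "feasible_route I z r (\<lambda>_ _. 0)
           (\<lambda>i j. if i = orig I r \<and> j = dest I r then 1 else 0)"
proof -
  have ne: "orig I r \<noteq> dest I r" "orig I r \<notin> hubs I" "dest I r \<notin> hubs I"
    and fin: "finite (hubs I)"
    using assms by (auto simp: odmts_instance_def dest: finite_subset)
  have fo: "finite {j. (i, j) \<in> shuttle_arcs I r}" "finite {j. (j, i) \<in> shuttle_arcs I r}" for i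
    by (rule finite_subset[of _ "insert (dest I r) (insert (orig I r) (hubs I))"];
        use fin in \<open>auto simp: shuttle_arcs_def\<close>)+
  have arc: "(orig I r, dest I r) \<in> shuttle_arcs I r" by (simp add: shuttle_arcs_def)
  have "(\<Sum>j | (i, j) \<in> shuttle_arcs I r. if i = orig I r \<and> j = dest I r then 1 else 0) =
      (if i = orig I r then 1 else 0 :: real)"
    "(\<Sum>j | (j, i) \<in> shuttle_arcs I r. if j = orig I r \<and> i = dest I r then 1 else 0) =
      (if i = dest I r then 1 else 0 :: real)" for i
    using fo[of i] arc by (auto simp: sum.delta)
  moreover have "z h l \<ge> 0" if "h \<in> hubs I" "l \<in> hubs I" for h l
  proof -
    have "z h l = 0 \<or> z h l = 1"
      using assms(2) that by (simp add: transit_design_def binary_on_def)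
    then show ?thesis by auto
  qed
  ultimately show ?thesis
    using ne
    by (auto simp: feasible_route_def net_outflow_def binary_on_def transit_design_def)
qed

lemma optimal_route_exists:
  assumes "odmts_instance I" "transit_design I z" "r \<in> trips I"
  shows "\<exists>x y. optimal_route I z r x y"
proof -
  have fH: "finite (hubs I \<times> hubs I)" and fA: "finite (shuttle_arcs I r)"
    using assms(1) by (auto simp: odmts_instance_def shuttle_arcs_def dest: finite_subset)
  define S where "S = {(route_weight I r x y, route_time I r x y) |x y. feasible_route I z r x y}"
  define V where "V = (\<lambda>(X, Y).
    ((\<Sum>(h, l)\<in>X. bus_weight I h l) + (\<Sum>(i, j)\<in>Y. shuttle_weight I i j),
     (\<Sum>(h, l)\<in>X. travel_time I h l + bus_wait I) + (\<Sum>(i, j)\<in>Y. travel_time I i j)))"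
  have "S \<subseteq> V ` (Pow (hubs I \<times> hubs I) \<times> Pow (shuttle_arcs I r))"
  proof
    fix p assume "p \<in> S"
    then obtain x y where p: "p = (route_weight I r x y, route_time I r x y)"
      and f: "feasible_route I z r x y" by (auto simp: S_def)
    have b: "binary_on (hubs I \<times> hubs I) x" "binary_on (shuttle_arcs I r) y"
      using f by (auto simp: feasible_route_def)
    have "p = V ({p \<in> hubs I \<times> hubs I. x (fst p) (snd p) = 1},
        {p \<in> shuttle_arcs I r. y (fst p) (snd p) = 1})"
      unfolding p V_def route_weight_def route_time_def
      by (simp only: sum_binary[OF fH b(1)] sum_binary[OF fA b(2)] prod.case)
    then show "p \<in> V ` (Pow (hubs I \<times> hubs I) \<times> Pow (shuttle_arcs I r))" by blast
  qed
  then have fin: "finite S" by (rule finite_subset) (use fH fA in simp)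
  have ne: "S \<noteq> {}" using direct_route_feasible[OF assms] by (auto simp: S_def)
  define b where "b = Min (fst ` S)"
  have "b \<in> fst ` S" unfolding b_def using fin ne by (intro Min_in) auto
  then have ne': "{p \<in> S. fst p = b} \<noteq> {}" by auto
  define f where "f = Min (snd ` {p \<in> S. fst p = b})"
  have "f \<in> snd ` {p \<in> S. fst p = b}" unfolding f_def using fin ne' by (intro Min_in) auto
  then have "(b, f) \<in> S" by auto
  then obtain x y where xy: "feasible_route I z r x y"
    "b = route_weight I r x y" "f = route_time I r x y" by (auto simp: S_def)
  have "b < b' \<or> b = b' \<and> f \<le> f'" if "(b', f') \<in> S" for b' f'
  proof -
    have "b \<le> b'" unfolding b_def using that fin by (intro Min_le) force+
    moreover have "f \<le> f'" if "b' = b"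
      unfolding f_def using \<open>(b', f') \<in> S\<close> that fin by (intro Min_le) force+
    ultimately show ?thesis by force
  qed
  then have "optimal_route I z r x y"
    unfolding optimal_route_def using xy by (auto simp: S_def)
  then show ?thesis by blast
qed

end

theory Submission imports Defs begin

text \<open>The weight of a route is \<open>(1 - \<theta>) g D + \<theta> f\<close>, where \<open>D\<close> is its shuttle distance and
  \<open>f\<close> its travel time. If the strengthened cut failed at a design \<open>z\<close> with \<open>\<delta> = 0\<close>, then \<open>z\<close>
  would extend \<open>z1\<close> without activating any hub closer to the origin or destination than \<open>m\<close> and
  \<open>n\<close>. The old route stays feasible, so the new optimum is lexicographically no worse; a new
  route that rides a bus has at least the old shuttle distance, so a smaller weight forces a
  smaller time. A new route that rides no bus is dominated by the direct ride, which was already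
  available under \<open>z1\<close>. Either way the trip time does not increase and the rider still
  adopts.\<close>

section \<open>Shape of feasible routes\<close>

lemma binary_sum_eq_one:
  fixes u :: "'a \<Rightarrow> real"
  assumes "finite A" "\<And>a. a \<in> A \<Longrightarrow> u a \<in> {0, 1}" "sum u A = 1"
  obtains a where "a \<in> A" "\<And>b. b \<in> A \<Longrightarrow> u b = of_bool (b = a)"
proof -
  have "\<exists>a\<in>A. u a \<noteq> 0"
    using assms(3) by (metis sum.neutral zero_neq_one)
  then obtain a where a: "a \<in> A" "u a = 1" using assms(2) by auto
  have "sum u (A - {a}) = 0"
    using sum.remove[OF assms(1) a(1), of u] a(2) assms(3) by simp
  moreover have "0 \<le> u b" if "b \<in> A" for b using assms(2)[OF that] by auto
  ultimately have "\<forall>b\<in>A - {a}. u b = 0"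
    using assms(1) by (subst (asm) sum_nonneg_eq_0_iff) auto
  then show ?thesis using a that by auto
qed

text \<open>Neither endpoint of the trip is a hub, so the three kinds of shuttle arc are
  disjoint.\<close>

lemma sum_shuttle_arcs:
  fixes f :: "'n \<Rightarrow> 'n \<Rightarrow> real"
  assumes "finite (hubs I)" "orig I r \<notin> hubs I" "dest I r \<notin> hubs I"
  shows "(\<Sum>(i, j)\<in>shuttle_arcs I r. f i j) =
    (\<Sum>h\<in>hubs I. f (orig I r) h) + (\<Sum>h\<in>hubs I. f h (dest I r)) + f (orig I r) (dest I r)"
proof -
  have "(\<Sum>(i, j)\<in>shuttle_arcs I r. f i j) =
      (\<Sum>(i, j)\<in>{orig I r} \<times> hubs I. f i j) + (\<Sum>(i, j)\<in>hubs I \<times> {dest I r}. f i j)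
      + f (orig I r) (dest I r)"
    unfolding shuttle_arcs_def using assms
    by (subst sum.union_disjoint; (subst sum.union_disjoint)?) auto
  also have "(\<Sum>(i, j)\<in>{orig I r} \<times> hubs I. f i j) = (\<Sum>h\<in>hubs I. f (orig I r) h)"
    by (subst sum.cartesian_product[symmetric]) simp
  also have "(\<Sum>(i, j)\<in>hubs I \<times> {dest I r}. f i j) = (\<Sum>h\<in>hubs I. f h (dest I r))"
    by (subst sum.cartesian_product[symmetric]) simp
  finally show ?thesis .
qed

text \<open>No shuttle arc enters the origin and none leaves the destination. Flow conservation
  there makes a sum of binary variables equal to 1, so exactly one shuttle leaves the origin and
  exactly one reaches the destination. Conservation at the hubs then fixes the net bus flow;
  \<open>x\<close> is not claimed to be a path and may contain cycles. Letting \<open>c\<close> be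
  arbitrary gives shuttle distance and shuttle time from one case split.\<close>

lemma feasible_route_cases:
  fixes x y :: "'n \<Rightarrow> 'n \<Rightarrow> real"
  assumes "odmts_instance I" "r \<in> trips I" "feasible_route I z r x y"
  obtains (direct)
      "\<And>h. h \<in> hubs I \<Longrightarrow> y (orig I r) h = 0"
      "\<And>c. (\<Sum>(i, j)\<in>shuttle_arcs I r. c i j * y i j) = c (orig I r) (dest I r)"
  | (via_hubs) h k where "h \<in> hubs I" "k \<in> hubs I"
      "\<And>i. i \<in> hubs I \<Longrightarrow> y (orig I r) i = of_bool (i = h)"
      "\<And>i. i \<in> hubs I \<Longrightarrow> y i (dest I r) = of_bool (i = k)"
      "\<And>c. (\<Sum>(i, j)\<in>shuttle_arcs I r. c i j * y i j) = c (orig I r) h + c k (dest I r)"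
      "\<And>i. i \<in> hubs I \<Longrightarrow>
         (\<Sum>l\<in>hubs I. x i l) - (\<Sum>l\<in>hubs I. x l i) = of_bool (i = h) - of_bool (i = k)"
proof -
  let ?H = "hubs I" and ?o = "orig I r" and ?d = "dest I r"
  have ne: "?o \<noteq> ?d" "?o \<notin> ?H" "?d \<notin> ?H" and nodes: "?o \<in> nodes I" "?d \<in> nodes I" "?H \<subseteq> nodes I"
    and fin: "finite ?H"
    using assms by (auto simp: odmts_instance_def dest: finite_subset)
  have flow: "net_outflow I r x y i = (if i = ?o then 1 else if i = ?d then -1 else 0)"
    if "i \<in> nodes I" for i using assms(3) that by (auto simp: feasible_route_def)
  have bin: "y i j \<in> {0, 1}" if "(i, j) \<in> shuttle_arcs I r" for i j
    using assms(3) that unfolding feasible_route_def binary_on_def by blast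
  have arcs: "{j. (?o, j) \<in> shuttle_arcs I r} = insert ?d ?H" "{j. (j, ?o) \<in> shuttle_arcs I r} = {}"
    "{j. (?d, j) \<in> shuttle_arcs I r} = {}" "{j. (j, ?d) \<in> shuttle_arcs I r} = insert ?o ?H"
    using ne by (auto simp: shuttle_arcs_def)
  have hub_arcs: "{j. (i, j) \<in> shuttle_arcs I r} = {?d}" "{j. (j, i) \<in> shuttle_arcs I r} = {?o}"
    if "i \<in> ?H" for i using ne that by (auto simp: shuttle_arcs_def)
  have "(\<Sum>j\<in>insert ?d ?H. y ?o j) = 1"
    using flow[OF nodes(1)] ne arcs by (simp add: net_outflow_def)
  then obtain h where h: "h \<in> insert ?d ?H" "\<And>j. j \<in> insert ?d ?H \<Longrightarrow> y ?o j = of_bool (j = h)"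
    using binary_sum_eq_one[of "insert ?d ?H" "y ?o"] bin fin arcs(1) by blast
  have "(\<Sum>i\<in>insert ?o ?H. y i ?d) = 1"
    using flow[OF nodes(2)] ne arcs by (simp add: net_outflow_def)
  then obtain k where k: "k \<in> insert ?o ?H" "\<And>i. i \<in> insert ?o ?H \<Longrightarrow> y i ?d = of_bool (i = k)"
    using binary_sum_eq_one[of "insert ?o ?H" "\<lambda>i. y i ?d"] bin fin arcs(4) by blast
  \<comment> \<open>The direct arc occurs in both unit sums, so either both select it or neither
    does. This rules out mixed routes.\<close>
  have yd: "y ?o ?d = of_bool (h = ?d)" "y ?o ?d = of_bool (k = ?o)"
    using h(2)[OF insertI1] k(2)[OF insertI1] by (auto simp: of_bool_def split: if_splits)
  then have iff: "h = ?d \<longleftrightarrow> k = ?o" by (auto simp: of_bool_def split: if_splits)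
  have yh: "y ?o i = of_bool (i = h)" and yk: "y i ?d = of_bool (i = k)" if "i \<in> ?H" for i
    using h(2) k(2) that by auto
  have delta: "(\<Sum>i\<in>?H. f i * of_bool (i = a)) = (if a \<in> ?H then f a else 0)"
    for f :: "'n \<Rightarrow> real" and a
  proof -
    have "(\<Sum>i\<in>?H. f i * of_bool (i = a)) = (\<Sum>i\<in>?H. if i = a then f a else 0)"
      by (intro sum.cong) auto
    then show ?thesis using fin by simp
  qed
  have total: "(\<Sum>(i, j)\<in>shuttle_arcs I r. c i j * y i j) =
      (if h \<in> ?H then c ?o h else 0) + (if k \<in> ?H then c k ?d else 0)
      + c ?o ?d * of_bool (h = ?d)" for c
    unfolding sum_shuttle_arcs[OF fin ne(2,3)] yd(1)
    using delta[of "c ?o" h] delta[of "\<lambda>i. c i ?d" k] by (simp add: yh yk cong: sum.cong)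
  show thesis
  proof (cases "h = ?d")
    case True
    then have "k = ?o" using iff by simp
    show thesis
    proof (rule direct)
      show "y ?o i = 0" if "i \<in> ?H" for i using yh[OF that] that True ne by auto
      show "(\<Sum>(i, j)\<in>shuttle_arcs I r. c i j * y i j) = c ?o ?d" for c
        unfolding total using True \<open>k = ?o\<close> ne by simp
    qed
  next
    case False
    then have hk: "h \<in> ?H" "k \<in> ?H" using iff h(1) k(1) by auto
    show thesis
    proof (rule via_hubs[OF hk])
      show "y ?o i = of_bool (i = h)" "y i ?d = of_bool (i = k)" if "i \<in> ?H" for i
        using yh yk that by auto
      show "(\<Sum>(i, j)\<in>shuttle_arcs I r. c i j * y i j) = c ?o h + c k ?d" for c
        unfolding total using False hk by simp
      show "(\<Sum>l\<in>?H. x i l) - (\<Sum>l\<in>?H. x l i) = of_bool (i = h) - of_bool (i = k)"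
        if "i \<in> ?H" for i
      proof -
        have "net_outflow I r x y i = 0" "i \<noteq> ?o" "i \<noteq> ?d"
          using flow[of i] that nodes ne by auto
        then show ?thesis
          using that hub_arcs[OF that] yh[OF that] yk[OF that] by (simp add: net_outflow_def)
      qed
    qed
  qed
qed

section \<open>Weight and time of a route\<close>

lemma route_weight_eq:
  "route_weight I r x y =
     (1 - theta I) * shuttle_cost I * (\<Sum>(i, j)\<in>shuttle_arcs I r. distance I i j * y i j) +
     theta I * route_time I r x y"
  by (simp add: route_weight_def route_time_def bus_weight_def shuttle_weight_def
      sum_distrib_left sum.distrib[symmetric] case_prod_beta algebra_simps)

definition bus_time :: "('n, 'r) odmts \<Rightarrow> ('n \<Rightarrow> 'n \<Rightarrow> real) \<Rightarrow> real" where
  "bus_time I x = (\<Sum>(h, l)\<in>hubs I \<times> hubs I. (travel_time I h l + bus_wait I) * x h l)"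

lemma bus_time_nonneg:
  assumes "odmts_instance I" "binary_on (hubs I \<times> hubs I) x"
  shows "0 \<le> bus_time I x"
  unfolding bus_time_def
proof (rule sum_nonneg, clarify)
  fix h l assume hl: "h \<in> hubs I" "l \<in> hubs I"
  then have "x h l = 0 \<or> x h l = 1" using assms(2) by (simp add: binary_on_def)
  moreover have "0 \<le> travel_time I h l" "0 \<le> bus_wait I"
    using assms(1) hl unfolding odmts_instance_def by blast+
  ultimately show "0 \<le> (travel_time I h l + bus_wait I) * x h l" by auto
qed

section \<open>Active hubs and closest distances\<close>

lemma transit_design_cases:
  assumes "transit_design I z" "h \<in> hubs I" "l \<in> hubs I"
  shows "z h l = 0 \<or> z h l = 1"
  using assms by (simp add: transit_design_def binary_on_def)

text \<open>An inactive hub has no open outgoing leg and, by weak connectivity, no open incoming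
  one. Since \<open>x\<close> lies below \<open>z\<close>, both bus flows there vanish and are
  balanced.\<close>

lemma active_hub_if_unbalanced:
  assumes z: "transit_design I z" and f: "feasible_route I z r x y"
    and h: "h \<in> hubs I" and ne: "(\<Sum>l\<in>hubs I. x h l) \<noteq> (\<Sum>l\<in>hubs I. x l h)"
  shows "h \<in> active_hubs I z"
proof (rule ccontr)
  have z0: "0 \<le> z i j" if "i \<in> hubs I" "j \<in> hubs I" for i j
    using transit_design_cases[OF z that] by auto
  have x: "0 \<le> x i j" "x i j \<le> z i j" if "i \<in> hubs I" "j \<in> hubs I" for i j
  proof -
    have "x i j = 0 \<or> x i j = 1" using f that by (simp add: feasible_route_def binary_on_def)
    then show "0 \<le> x i j" by auto
    show "x i j \<le> z i j" using f that by (simp add: feasible_route_def)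
  qed
  assume "h \<notin> active_hubs I z"
  then have out: "(\<Sum>l\<in>hubs I. z h l) \<le> 0" using h by (auto simp: active_hubs_def)
  then have inn: "(\<Sum>l\<in>hubs I. z l h) \<le> 0" using z h by (simp add: transit_design_def)
  have "(\<Sum>l\<in>hubs I. x h l) \<le> (\<Sum>l\<in>hubs I. z h l)" "(\<Sum>l\<in>hubs I. x l h) \<le> (\<Sum>l\<in>hubs I. z l h)"
    using x h by (auto intro!: sum_mono)
  moreover have "0 \<le> (\<Sum>l\<in>hubs I. x h l)" "0 \<le> (\<Sum>l\<in>hubs I. x l h)"
    using x h by (auto intro!: sum_nonneg)
  ultimately show False using out inn ne by linarith
qed

lemma inactive_hub_no_legs:
  assumes "odmts_instance I" "transit_design I z" "h \<in> hubs I" "h \<notin> active_hubs I z" "l \<in> hubs I"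
  shows "z h l = 0"
proof -
  have fin: "finite (hubs I)"
    using assms by (auto simp: odmts_instance_def dest: finite_subset)
  have z0: "0 \<le> z h j" if "j \<in> hubs I" for j using transit_design_cases[OF assms(2,3) that] by auto
  then have "(\<Sum>l\<in>hubs I. z h l) \<ge> 0" by (auto intro: sum_nonneg)
  moreover have "(\<Sum>l\<in>hubs I. z h l) \<le> 0" using assms by (auto simp: active_hubs_def)
  ultimately have "(\<Sum>l\<in>hubs I. z h l) = 0" by linarith
  then show ?thesis using sum_nonneg_eq_0_iff[OF fin, of "z h"] z0 assms(5) by auto
qed

text \<open>An active hub takes part in the minimum; an inactive hub closer than the minimum would
  belong to \<open>W_from\<close>.\<close>

lemma dmin_from_le:
  assumes "odmts_instance I" "h \<in> hubs I" "h \<notin> W_from I z i"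
  shows "dmin_from I z i \<le> distance I i h"
proof (cases "h \<in> active_hubs I z")
  case True
  have "finite (active_hubs I z)"
    using assms by (auto simp: odmts_instance_def active_hubs_def dest: finite_subset)
  then show ?thesis unfolding dmin_from_def using True by (intro Min_le) auto
qed (use assms in \<open>auto simp: W_from_def\<close>)

lemma dmin_to_le:
  assumes "odmts_instance I" "h \<in> hubs I" "h \<notin> W_to I z i"
  shows "dmin_to I z i \<le> distance I h i"
proof (cases "h \<in> active_hubs I z")
  case True
  have "finite (active_hubs I z)"
    using assms by (auto simp: odmts_instance_def active_hubs_def dest: finite_subset)
  then show ?thesis unfolding dmin_to_def using True by (intro Min_le) auto
qed (use assms in \<open>auto simp: W_to_def\<close>)

section \<open>Comparison of trip times\<close>

lemma trip_time_extension_le: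
  fixes I :: "('n, 'r) odmts" and z1 z x y :: "'n \<Rightarrow> 'n \<Rightarrow> real"
  assumes inst: "odmts_instance I" and z1: "transit_design I z1" and z: "transit_design I z"
    and r: "r \<in> trips I" and opt: "optimal_route I z1 r x y"
    and m: "m \<in> hubs I" "y (orig I r) m = 1" "distance I (orig I r) m = dmin_from I z1 (orig I r)"
    and n: "n \<in> hubs I" "y n (dest I r) = 1" "distance I n (dest I r) = dmin_to I z1 (dest I r)"
    and ext: "\<And>h l. h \<in> hubs I \<Longrightarrow> l \<in> hubs I \<Longrightarrow> z1 h l = 1 \<Longrightarrow> z h l = 1"
    and W: "active_hubs I z \<inter> (W_from I z1 (orig I r) \<union> W_to I z1 (dest I r)) = {}"
  shows "trip_time I z r \<le> trip_time I z1 r"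
proof -
  let ?H = "hubs I" and ?o = "orig I r" and ?d = "dest I r" and ?A = "shuttle_arcs I r"
  let ?t = "travel_time I" and ?D = "\<lambda>y. \<Sum>(i, j)\<in>?A. distance I i j * y i j"
  define w where "w = (1 - theta I) * shuttle_cost I"
  have w0: "0 \<le> w" and th0: "0 \<le> theta I" using inst by (auto simp: w_def odmts_instance_def)
  \<comment> \<open>An optimum under \<open>z\<close> has to exist for the description in
    \<open>trip_time I z r\<close> to denote a route time.\<close>
  obtain x' y' where opt': "optimal_route I z r x' y'"
    using optimal_route_exists[OF inst z r] by blast
  have f: "feasible_route I z1 r x y" and f': "feasible_route I z r x' y'"
    using opt opt' by (auto simp: optimal_route_def)
  have le: "z1 h l \<le> z h l" if "h \<in> ?H" "l \<in> ?H" for h l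
    using transit_design_cases[OF z1 that] transit_design_cases[OF z that] ext[OF that] by auto
  have "feasible_route I z r x y"
    using f le unfolding feasible_route_def by (meson order_trans)
  then have new_old: "route_weight I r x' y' < route_weight I r x y \<or>
      route_weight I r x' y' = route_weight I r x y \<and> route_time I r x' y' \<le> route_time I r x y"
    using opt' by (auto simp: optimal_route_def)
  \<comment> \<open>The arcs to \<open>m\<close> and from \<open>n\<close> are the only shuttle arcs
    of the old route; the direct case contradicts \<open>y (orig I r) m = 1\<close>.\<close>
  have D_old: "?D y = distance I ?o m + distance I n ?d"
    using inst r f
  proof (cases rule: feasible_route_cases)
    case direct
    then show ?thesis using m by auto
  next
    case (via_hubs h k)
    have "m = h" "n = k"
      using via_hubs(3)[OF m(1)] via_hubs(4)[OF n(1)] m(2) n(2) by (auto simp: of_bool_def split: if_splits)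
    then show ?thesis using via_hubs(5)[of "distance I"] by simp
  qed
  \<comment> \<open>The direct ride uses no bus leg, so it competes with the old route under
    \<open>z1\<close>.\<close>
  let ?yd = "\<lambda>i j. if i = ?o \<and> j = ?d then 1 else (0::real)"
  have direct_feasible: "feasible_route I z1 r (\<lambda>_ _. 0) ?yd"
    using direct_route_feasible[OF inst z1 r] .
  have ne: "?o \<noteq> ?d" "?o \<notin> ?H" "?d \<notin> ?H" "?o \<in> nodes I" "?d \<in> nodes I"
    and sub: "?H \<subseteq> nodes I" and fin: "finite ?H"
    using inst r by (auto simp: odmts_instance_def dest: finite_subset)
  have direct_sum: "(\<Sum>(i, j)\<in>?A. c i j * ?yd i j) = c ?o ?d" for c :: "'n \<Rightarrow> 'n \<Rightarrow> real"
    proof -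
    have "h \<noteq> ?o" "h \<noteq> ?d" if "h \<in> ?H" for h using ne that by auto
    then show ?thesis using ne(1) by (simp add: sum_shuttle_arcs[OF fin ne(2,3)] cong: sum.cong)
  qed
  have time_eq: "route_time I r u v = bus_time I u + (\<Sum>(i, j)\<in>?A. ?t i j * v i j)" for u v
    by (simp add: route_time_def bus_time_def)
  have bus0: "0 \<le> bus_time I x'"
    using f' by (intro bus_time_nonneg[OF inst]) (simp add: feasible_route_def)
  have D_direct: "?D ?yd = distance I ?o ?d" by (rule direct_sum)
  have time_direct: "route_time I r (\<lambda>_ _. 0) ?yd = ?t ?o ?d"
    unfolding time_eq direct_sum by (simp add: bus_time_def)
  \<comment> \<open>The weights are squeezed: old at most direct by optimality under
    \<open>z1\<close>, direct at most new by \<open>D\<close> and \<open>T\<close>, new at most old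
    by \<open>new_old\<close>. So old and new tie in weight, and the tie-break in
    \<open>new_old\<close> compares their times.\<close>
  have dominated: "route_time I r x' y' \<le> route_time I r x y"
    if D: "distance I ?o ?d \<le> ?D y'" and T: "?t ?o ?d \<le> route_time I r x' y'"
  proof -
    have "route_weight I r (\<lambda>_ _. 0) ?yd \<le> route_weight I r x' y'"
      unfolding route_weight_eq D_direct time_direct w_def[symmetric]
      using mult_left_mono[OF D w0] mult_left_mono[OF T th0] by linarith
    moreover have "route_weight I r x y < route_weight I r (\<lambda>_ _. 0) ?yd \<or>
        route_weight I r x y = route_weight I r (\<lambda>_ _. 0) ?yd \<and>
        route_time I r x y \<le> route_time I r (\<lambda>_ _. 0) ?yd"
      using opt direct_feasible unfolding optimal_route_def by blast
    ultimately show ?thesis using new_old by linarith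
  qed
  have "route_time I r x' y' \<le> route_time I r x y"
    using inst r f'
  proof (cases rule: feasible_route_cases)
    \<comment> \<open>The bus variables may still carry a circulation, which only adds nonnegative
      time.\<close>
    case direct
    then show ?thesis using dominated bus0 by (simp add: time_eq)
  next
    case (via_hubs h k)
    note [simp] = via_hubs(5)
    show ?thesis
    proof (cases "h = k")
      \<comment> \<open>With equal entry and exit hubs no bus ride is forced, so this hub may be
        inactive. The triangle inequalities for distance and time reduce the case to the direct
        ride.\<close>
      case True
      have "h \<in> nodes I" using via_hubs sub by auto
      then have "distance I ?o ?d \<le> distance I ?o h + distance I h ?d"
        "?t ?o ?d \<le> ?t ?o h + ?t h ?d"
        using inst ne unfolding odmts_instance_def by blast+
      then show ?thesis using dominated bus0 True by (simp add: time_eq)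
    next
      case False
      \<comment> \<open>The net bus flow is 1 at \<open>h\<close> and -1 at \<open>k\<close>, so
        both hubs are unbalanced.\<close>
      have "h \<in> active_hubs I z" "k \<in> active_hubs I z"
        using via_hubs(1,2) via_hubs(6)[of h] via_hubs(6)[of k] False
        by (auto intro!: active_hub_if_unbalanced[OF z f'])
      then have "h \<notin> W_from I z1 ?o" "k \<notin> W_to I z1 ?d" using W by auto
      then have "?D y \<le> ?D y'"
        using dmin_from_le[OF inst via_hubs(1), of z1 ?o] dmin_to_le[OF inst via_hubs(2), of z1 ?d]
          m(3) n(3) D_old by simp
      then have "w * ?D y \<le> w * ?D y'" using w0 by (rule mult_left_mono)
      \<comment> \<open>A cheaper route can be slower only by saving shuttle distance, which is
        excluded here. The inequality is kept strict and multiplied by \<open>theta I\<close>: a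
        larger new time would contradict it even for \<open>theta I = 0\<close>, where division
        would fail.\<close>
      then have "theta I * route_time I r x' y' < theta I * route_time I r x y"
        if "route_weight I r x' y' < route_weight I r x y"
        using that unfolding route_weight_eq w_def[symmetric] by linarith
      then show ?thesis using new_old th0 by (metis less_eq_real_def linorder_not_le mult_left_mono)
    qed
  qed
  then show ?thesis using trip_time_eq[OF opt] trip_time_eq[OF opt'] by simp
qed

section \<open>From trip times to the cut\<close>

lemma one_le_sum_if_member:
  fixes f :: "'a \<Rightarrow> real"
  assumes "finite A" "\<And>a. a \<in> A \<Longrightarrow> 0 \<le> f a" "a \<in> A" "f a = 1"
  shows "1 \<le> sum f A"
  using member_le_sum[of a A f] assms by auto

text \<open>All three terms are nonnegative, so one of them reaching 1 suffices: a leg of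
  \<open>z1\<close> is closed, or a hub of the W sets becomes active, or else the hypothesis
  \<open>adopts\<close> yields \<delta>r = 1. The routing argument enters only through that
  hypothesis.\<close>

lemma strengthened_cut_holds:
  assumes inst: "odmts_instance I" and z: "transit_design I z" and \<delta>: "\<delta>r \<in> {0, 1}"
    and adopts: "\<lbrakk>\<And>h l. \<lbrakk>h \<in> hubs I; l \<in> hubs I; z1 h l = 1\<rbrakk> \<Longrightarrow> z h l = 1;
      active_hubs I z \<inter> (W_from I z1 (orig I r) \<union> W_to I z1 (dest I r)) = {}\<rbrakk> \<Longrightarrow> \<delta>r = 1"
  shows "strengthened_cut I r z1 z \<delta>r"
proof -
  let ?H = "hubs I" and ?W = "W_from I z1 (orig I r) \<union> W_to I z1 (dest I r)"
  let ?P = "{(h, l). h \<in> ?H \<and> l \<in> ?H \<and> z1 h l = 1}"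
  have fin: "finite ?H" using inst by (auto simp: odmts_instance_def dest: finite_subset)
  have WH: "?W \<subseteq> ?H" by (auto simp: W_from_def W_to_def)
  have fW: "finite (?W \<times> ?H)" using finite_subset[OF WH fin] fin by blast
  have fP: "finite ?P" by (rule finite_subset[of _ "?H \<times> ?H"]) (use fin in auto)
  have bounds: "0 \<le> z h l" "z h l \<le> 1" if "h \<in> ?H" "l \<in> ?H" for h l
    using transit_design_cases[OF z that] by auto
  have nnW: "0 \<le> (\<lambda>(h, l). z h l) p" if "p \<in> ?W \<times> ?H" for p using that WH bounds by auto
  have nnP: "0 \<le> (\<lambda>(h, l). 1 - z h l) p" if "p \<in> ?P" for p using that bounds by auto
  have ge: "0 \<le> (\<Sum>(h, l)\<in>?W \<times> ?H. z h l)" "0 \<le> (\<Sum>(h, l)\<in>?P. 1 - z h l)" "0 \<le> \<delta>r"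
    by (rule sum_nonneg, erule nnW) (rule sum_nonneg, erule nnP, use \<delta> in auto)
  consider "\<delta>r = 1" | h l where "h \<in> ?H" "l \<in> ?H" "z1 h l = 1" "z h l \<noteq> 1"
    | h where "h \<in> active_hubs I z" "h \<in> ?W"
    using adopts by blast
  then show ?thesis
  proof cases
    case 1
    then show ?thesis using ge by (simp add: strengthened_cut_def)
  next
    case (2 h l)
    then have "1 \<le> (\<Sum>(h, l)\<in>?P. 1 - z h l)"
      using one_le_sum_if_member[OF fP nnP, where a = "(h, l)"] transit_design_cases[OF z 2(1,2)] by auto
    then show ?thesis using ge by (simp add: strengthened_cut_def)
  next
    case (3 h)
    then have h: "h \<in> ?H" using WH by auto
    \<comment> \<open>A positive out-sum contains a nonzero leg, which integrality then makes equal
      to 1.\<close>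
    obtain l where l: "l \<in> ?H" "z h l \<noteq> 0"
      using 3(1) sum.neutral[of ?H "z h"] unfolding active_hubs_def by fastforce
    then have "1 \<le> (\<Sum>(h, l)\<in>?W \<times> ?H. z h l)"
      using one_le_sum_if_member[OF fW nnW, where a = "(h, l)"] transit_design_cases[OF z h l(1)] 3(2) by auto
    then show ?thesis using ge by (simp add: strengthened_cut_def)
  qed
qed

text \<open>Hubs in the W sets are inactive under \<open>z1\<close>, so every leg leaving them is
  closed there. The first sum is therefore part of the first sum of the basic cut, and the remaining
  terms of that sum are nonnegative.\<close>

lemma strengthened_cut_imp_consistency_cut:
  assumes inst: "odmts_instance I" and z1: "transit_design I z1"
    and z: "binary_on (hubs I \<times> hubs I) z" and cut: "strengthened_cut I r z1 z \<delta>r"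
  shows "consistency_cut I z1 z \<delta>r"
proof -
  let ?H = "hubs I" and ?W = "W_from I z1 (orig I r) \<union> W_to I z1 (dest I r)"
  let ?Z = "{(h, l). h \<in> ?H \<and> l \<in> ?H \<and> z1 h l = 0}"
  have fin: "finite ?H" using inst by (auto simp: odmts_instance_def dest: finite_subset)
  have "(\<Sum>(h, l)\<in>?W \<times> ?H. z h l) \<le> (\<Sum>(h, l)\<in>?Z. z h l)"
  proof (rule sum_mono2)
    show "finite ?Z" by (rule finite_subset[of _ "?H \<times> ?H"]) (use fin in auto)
    show "?W \<times> ?H \<subseteq> ?Z"
      using inactive_hub_no_legs[OF inst z1] by (auto simp: W_from_def W_to_def)
    show "0 \<le> (case p of (h, l) \<Rightarrow> z h l)" if "p \<in> ?Z - ?W \<times> ?H" for p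
    proof -
      have "p \<in> ?H \<times> ?H" using that by auto
      then show ?thesis using z by (force simp: binary_on_def)
    qed
  qed
  then show ?thesis using cut by (simp add: strengthened_cut_def consistency_cut_def)
qed

text \<open>The second conjunct expresses that the new cut strengthens the basic one, at every
  binary point and not just at weakly connected designs.\<close>

theorem proposition12:
  fixes I :: "('n, 'r) odmts" and z1 x y :: "'n \<Rightarrow> 'n \<Rightarrow> real" and r :: 'r and m n :: 'n
  assumes "odmts_instance I"
    and "transit_design I z1"
    and "r \<in> trips I"
    and "optimal_route I z1 r x y"
    and "m \<in> active_hubs I z1" and "n \<in> active_hubs I z1"
    and "y (orig I r) m = 1" and "y n (dest I r) = 1"
    and "distance I (orig I r) m = dmin_from I z1 (orig I r)"
    and "distance I n (dest I r) = dmin_to I z1 (dest I r)"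
    and "adopts I z1 r"
  shows "valid_cut I r (strengthened_cut I r z1) \<and>
    (\<forall>z \<delta>r. binary_on (hubs I \<times> hubs I) z \<and> \<delta>r \<in> {0, 1} \<and> strengthened_cut I r z1 z \<delta>r \<longrightarrow>
       consistency_cut I z1 z \<delta>r)"
proof (intro conjI allI impI)
  show "valid_cut I r (strengthened_cut I r z1)"
    unfolding valid_cut_def
  proof (intro allI impI)
    fix z \<delta> assume feas: "design_feasible I z \<delta>"
    then have z: "transit_design I z" by (simp add: design_feasible_def)
    show "strengthened_cut I r z1 z (\<delta> r)"
    proof (rule strengthened_cut_holds[OF assms(1) z])
      show "\<delta> r \<in> {0, 1}" using feas assms(3) unfolding design_feasible_def by blast
    next
      assume ext: "\<And>h l. \<lbrakk>h \<in> hubs I; l \<in> hubs I; z1 h l = 1\<rbrakk> \<Longrightarrow> z h l = 1"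
        and W: "active_hubs I z \<inter> (W_from I z1 (orig I r) \<union> W_to I z1 (dest I r)) = {}"
      have hubs: "m \<in> hubs I" "n \<in> hubs I" using assms(5,6) by (auto simp: active_hubs_def)
      have "trip_time I z r \<le> trip_time I z1 r"
        using trip_time_extension_le[OF assms(1,2) z assms(3,4) hubs(1) assms(7,9)
            hubs(2) assms(8,10) ext W] .
      then have "adopts I z r" using assms(11) by (simp add: adopts_def)
      then show "\<delta> r = 1" using feas assms(3) by (simp add: design_feasible_def)
    qed
  qed
next
  fix z \<delta>r
  assume "binary_on (hubs I \<times> hubs I) z \<and> \<delta>r \<in> {0, 1} \<and> strengthened_cut I r z1 z \<delta>r"
  then show "consistency_cut I z1 z \<delta>r"
    using strengthened_cut_imp_consistency_cut[OF assms(1,2)] by blast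
qed

end
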